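(* Let $n\ge 1$. For every non-zero $-1<m<1$ and each $K\subset[-1,1]^n$ such that $b(K)=m\mathbf{1}_n$, one has $$\sqrt[n]{\mathrm{vol}(K)}<2\sqrt{1-m^2}.$$
   Context: $\mathrm{vol}$ is Lebesgue measure on $\mathbb{R}^n$, and $\mathbf{1}_n=(1,1,\ldots,1)\in\mathbb{R}^n$. For a measurable set $A\subset\mathbb{R}^n$ (bounded, of positive volume), its barycenter is $b(A)=\frac{1}{\mathrm{vol}(A)}\int_A x\,dx$; the condition $b(K)=m\mathbf{1}_n$ presupposes that $K$ is measurable with positive volume. $K$ is not assumed convex. *)

theory Defs
  imports "HOL-Analysis.Analysis"
begin

definition barycenter :: "(real ^ 'n) set \<Rightarrow> real ^ 'n" where
  "barycenter A = (1 / measure lebesgue A) *\<^sub>R (LINT x:A|lebesgue. x)"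

end

theory Submission
  imports Defs "HOL-Real_Asymp.Real_Asymp"
begin

text \<open>
  The bound comes from a maximum entropy principle, used in its dual form. If \<open>c\<close> is the barycenter
  of \<open>K\<close> then, for every vector \<open>v\<close>, the function \<open>x \<mapsto> exp (v \<bullet> (x - c))\<close> lies above
  \<open>1 + v \<bullet> (x - c)\<close>, whose integral over \<open>K\<close> is exactly the volume of \<open>K\<close>. So the volume of \<open>K\<close>
  is at most the integral of the exponential over \<open>K\<close>, hence over any box containing \<open>K\<close>
  (\<open>measure_le_exp_integral\<close>). The last integral is a product of one-dimensional ones
  (\<open>exp_integral_cbox\<close>). With the cube \<open>[-1,1]\<^sup>n\<close>, \<open>c = (m,\<dots>,m)\<close> and
  \<open>v = (t,\<dots>,t)\<close>, the \<open>n\<close>-th root of the volume is at most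
  \<open>2 (sinh t / t) exp (- t m)\<close>, for every \<open>t \<noteq> 0\<close>.

  It remains to choose \<open>t\<close>. Multiplied by \<open>exp (t m)\<close>, the bound to be proved is
  \<open>sinh t / t < exp (t m) sqrt (1 - m\<^sup>2)\<close>, and \<open>m\<close> is a critical point of the right-hand
  side when \<open>t = m / (1 - m\<^sup>2)\<close>. This choice makes the dependence of \<open>t\<close> on \<open>m\<close> easy to
  handle: the logarithm of the right-hand side over the left-hand side has a derivative in \<open>m\<close>
  whose sign is that of \<open>m - coth t + 1 / t\<close>, which an elementary argument shows to be positive
  (\<open>langevin_less\<close>). The logarithm vanishes in the limit at \<open>0\<close>, so it is positive
  on \<open>(0,1)\<close> (\<open>sinh_over_less\<close>). Negative \<open>m\<close> follow since both sides are even under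
  \<open>(t, m) \<mapsto> (-t, -m)\<close>.
\<close>

section \<open>The one-dimensional inequality\<close>

lemma less_sinh_times_cosh:
  fixes t :: real
  assumes "0 < t"
  shows "t < sinh t * cosh t"
proof -
  have "sinh 0 * cosh 0 - 0 < sinh t * cosh t - t"
  proof (rule DERIV_pos_imp_increasing_open[OF assms])
    fix x :: real
    assume x: "0 < x"
    have "((\<lambda>x. sinh x * cosh x - x) has_real_derivative cosh x * cosh x + sinh x * sinh x - 1) (at x)"
      by (auto intro!: derivative_eq_intros)
    moreover have "cosh x * cosh x + sinh x * sinh x - 1 = 2 * (sinh x)\<^sup>2"
      by (simp add: cosh_square_eq flip: power2_eq_square)
    moreover have "2 * (sinh x)\<^sup>2 > 0"
      using x by simp
    ultimately show "\<exists>y. ((\<lambda>x. sinh x * cosh x - x) has_real_derivative y) (at x) \<and> 0 < y"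
      by auto
  qed (auto intro!: continuous_intros)
  then show ?thesis by simp
qed

text \<open>
  The left-hand side is the mean of the density proportional to \<open>exp (t x)\<close> on \<open>[-1,1]\<close>.
  Multiplied by \<open>t\<close> and shifted by \<open>1\<close>, the two sides become \<open>u = t coth t\<close> and
  \<open>w = 1 / (1 - x\<^sup>2)\<close>. Since \<open>w\<^sup>2 - w = t\<^sup>2\<close> and \<open>y \<mapsto> y\<^sup>2 - y\<close> increases on \<open>[1,\<infinity>)\<close>,
  it is enough that \<open>u\<^sup>2 - u < t\<^sup>2\<close>, which amounts to \<open>t < sinh t cosh t\<close>.
\<close>

lemma langevin_less:
  fixes x :: real
  assumes x: "0 < x" "x < 1"
  defines "t \<equiv> x / (1 - x\<^sup>2)"
  shows "cosh t / sinh t - 1 / t < x"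
proof -
  have q: "0 < 1 - x\<^sup>2"
    using x by (simp add: abs_square_less_1)
  then have t: "0 < t"
    using x by (simp add: t_def)
  define u where "u = t * cosh t / sinh t"
  define w where "w = 1 / (1 - x\<^sup>2)"
  have s: "0 < sinh t" using t by simp
  have w1: "1 \<le> w" using q by (simp add: w_def field_simps)
  have tw: "t = x * w"
    by (simp add: t_def w_def)
  have "w * (1 - x\<^sup>2) = 1"
    using q by (simp add: w_def)
  then have w: "w = t * x + 1"
    by (simp add: tw algebra_simps power2_eq_square)
  have "w\<^sup>2 - w = w * (w - 1)"
    by (simp add: algebra_simps power2_eq_square)
  also have "\<dots> = w * (t * x)"
    by (subst (2) w) simp
  finally have ww: "w\<^sup>2 - w = t\<^sup>2"
    by (simp add: tw algebra_simps power2_eq_square)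
  have "cosh t * cosh t = 1 + sinh t * sinh t"
    using cosh_square_eq[of t] by (simp add: power2_eq_square)
  then have "u\<^sup>2 - u - t\<^sup>2 = t * (t - sinh t * cosh t) / (sinh t)\<^sup>2"
    using s by (simp add: u_def field_simps power2_eq_square)
  also have "\<dots> < 0"
    using s t less_sinh_times_cosh[OF t] by (intro divide_neg_pos mult_pos_neg) auto
  finally have uu: "u\<^sup>2 - u < w\<^sup>2 - w"
    using ww by simp
  have "u < w"
  proof (rule ccontr)
    assume "\<not> u < w"
    then have "0 \<le> (u - w) * (u + w - 1)"
      using w1 by (intro mult_nonneg_nonneg) auto
    then show False
      using uu by (simp add: algebra_simps power2_eq_square)
  qed
  then show ?thesis
    using t s by (simp add: u_def w field_simps)
qed

lemma sinh_over_less: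
  fixes m :: real
  assumes m: "0 < m" "m < 1"
  defines "t \<equiv> m / (1 - m\<^sup>2)"
  shows "sinh t / t * exp (- (t * m)) < sqrt (1 - m\<^sup>2)"
proof -
  define T :: "real \<Rightarrow> real" where "T = (\<lambda>x. x / (1 - x\<^sup>2))"
  define G where "G = (\<lambda>x. T x * x + ln (1 - x\<^sup>2) / 2 - ln (sinh (T x)) + ln (T x))"
  have q: "0 < 1 - x\<^sup>2" if "0 < x" "x < 1" for x :: real
    using that by (simp add: abs_square_less_1)
  have T0: "0 < T x" if "0 < x" "x < 1" for x
    using q[OF that] that by (simp add: T_def)
  have mono: "G a < G b" if ab: "0 < a" "a < b" "b < 1" for a b
  proof (rule DERIV_pos_imp_increasing[OF ab(2)])
    fix x assume "a \<le> x" "x \<le> b"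
    then have x: "0 < x" "x < 1" using ab by auto
    define T' where "T' = (1 + x\<^sup>2) / (1 - x\<^sup>2)\<^sup>2"
    have T': "(T has_real_derivative T') (at x)"
      unfolding T_def T'_def using q[OF x]
      by (auto intro!: derivative_eq_intros simp: field_simps power2_eq_square)
    have "0 < T'"
      unfolding T'_def using q[OF x] by (intro divide_pos_pos add_pos_nonneg) auto
    have "(G has_real_derivative
        T' * x + T x - x / (1 - x\<^sup>2) - T' * cosh (T x) / sinh (T x) + T' / T x) (at x)"
      unfolding G_def using q[OF x] T0[OF x]
      by (auto intro!: derivative_eq_intros T' simp: field_simps)
    moreover have "T' * x + T x - x / (1 - x\<^sup>2) - T' * cosh (T x) / sinh (T x) + T' / T x
        = T' * (x - (cosh (T x) / sinh (T x) - 1 / T x))"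
      by (simp add: T_def algebra_simps)
    moreover have "0 < T' * (x - (cosh (T x) / sinh (T x) - 1 / T x))"
      using \<open>0 < T'\<close> langevin_less[OF x] by (simp add: T_def)
    ultimately show "\<exists>y. (G has_real_derivative y) (at x) \<and> 0 < y"
      by auto
  qed
  have lim: "(G \<longlongrightarrow> 0) (at_right 0)"
    unfolding G_def T_def by real_asymp
  have "0 \<le> G (m / 2)"
  proof (rule tendsto_upperbound[OF lim])
    show "\<forall>\<^sub>F x in at_right 0. G x \<le> G (m / 2)"
      unfolding eventually_at_right_field
      using m mono[of _ "m / 2"] by (intro exI[of _ "m / 2"]) (auto intro!: less_imp_le)
  qed simp
  also have "G (m / 2) < G m"
    using m by (intro mono) auto
  finally have "ln (sinh t) - ln t - t * m < ln (1 - m\<^sup>2) / 2"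
    by (simp add: G_def T_def t_def)
  moreover have t: "0 < t" using T0[OF m] by (simp add: T_def t_def)
  moreover have "ln (sinh t / t * exp (- (t * m))) = ln (sinh t) - ln t - t * m"
    using t by (simp add: ln_mult ln_div)
  moreover have "ln (sqrt (1 - m\<^sup>2)) = ln (1 - m\<^sup>2) / 2"
    using q[OF m] by (simp add: ln_sqrt)
  ultimately have "ln (sinh t / t * exp (- (t * m))) < ln (sqrt (1 - m\<^sup>2))"
    by simp
  then show ?thesis
    using t q[OF m] by (subst (asm) ln_less_cancel_iff) auto
qed

lemma sinh_over_less_nonzero:
  fixes m :: real
  assumes "m \<noteq> 0" "-1 < m" "m < 1"
  defines "t \<equiv> m / (1 - m\<^sup>2)"
  shows "sinh t / t * exp (- (t * m)) < sqrt (1 - m\<^sup>2)"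
proof (cases "0 < m")
  case True
  then show ?thesis using sinh_over_less[of m] assms by simp
next
  case False
  then show ?thesis using sinh_over_less[of "- m"] assms by simp
qed

section \<open>Bounding a volume by an exponential integral\<close>

text \<open>
  The affine minorant \<open>1 + v \<bullet> (x - c)\<close> of the exponential integrates to the volume of \<open>K\<close>,
  because its linear part integrates to \<open>0\<close> around the barycenter.
\<close>

lemma measure_le_exp_integral:
  fixes K :: "'a::euclidean_space set" and a b c v :: 'a
  assumes KC: "K \<subseteq> cbox a b" and K: "K \<in> sets lebesgue"
    and bary: "(LINT x:K|lebesgue. x) = measure lebesgue K *\<^sub>R c"
  shows "measure lebesgue K \<le> (LINT x:cbox a b|lebesgue. exp (v \<bullet> (x - c)))"
proof -
  have intC: "set_integrable lebesgue (cbox a b) f"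
    if "continuous_on (cbox a b) f" for f :: "'a \<Rightarrow> real"
    using that by (rule absolutely_integrable_continuous)
  have intK: "set_integrable lebesgue K f"
    if "continuous_on (cbox a b) f" for f :: "'a \<Rightarrow> real"
    using intC[OF that] K KC by (rule set_integrable_subset)
  have idK: "set_integrable lebesgue K (\<lambda>x. x)"
    by (rule set_integrable_subset[OF absolutely_integrable_continuous K KC]) (rule continuous_on_id)
  have fin: "emeasure lebesgue K < \<infinity>"
    using bounded_set_imp_lmeasurable[OF bounded_subset[OF bounded_cbox KC] K] 
    unfolding fmeasurable_def by blast
  have "(LINT x:K|lebesgue. v \<bullet> x) = v \<bullet> (LINT x:K|lebesgue. x)"
    using integral_inner_right[of v lebesgue "\<lambda>x. indicator K x *\<^sub>R x"] idK
    by (simp add: set_lebesgue_integral_def set_integrable_def)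
  then have lin: "(LINT x:K|lebesgue. v \<bullet> x) = measure lebesgue K * (v \<bullet> c)"
    by (simp add: bary)
  have const: "(LINT x:K|lebesgue. r) = measure lebesgue K * r" for r :: real
    using K fin by (simp add: set_lebesgue_integral_def)
  have "(LINT x:K|lebesgue. (1 - v \<bullet> c) + v \<bullet> x)
      = (LINT x:K|lebesgue. 1 - v \<bullet> c) + (LINT x:K|lebesgue. v \<bullet> x)"
    by (intro set_integral_add intK continuous_intros)
  then have "measure lebesgue K = (LINT x:K|lebesgue. (1 - v \<bullet> c) + v \<bullet> x)"
    by (simp add: lin const algebra_simps)
  also have "\<dots> \<le> (LINT x:K|lebesgue. exp (v \<bullet> (x - c)))"
  proof (intro set_integral_mono intK continuous_intros)
    show "(1 - v \<bullet> c) + v \<bullet> x \<le> exp (v \<bullet> (x - c))" for x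
      using exp_ge_add_one_self[of "v \<bullet> (x - c)"] unfolding inner_diff_right by linarith
  qed
  also have "\<dots> \<le> (LINT x:cbox a b|lebesgue. exp (v \<bullet> (x - c)))"
    unfolding set_lebesgue_integral_def
  proof (rule integral_mono)
    show "integrable lebesgue (\<lambda>x. indicator K x *\<^sub>R exp (v \<bullet> (x - c)))"
      using intK[of "\<lambda>x. exp (v \<bullet> (x - c))"]
      by (simp add: set_integrable_def continuous_intros)
    show "integrable lebesgue (\<lambda>x. indicator (cbox a b) x *\<^sub>R exp (v \<bullet> (x - c)))"
      using intC[of "\<lambda>x. exp (v \<bullet> (x - c))"]
      by (simp add: set_integrable_def continuous_intros)
  qed (use KC in \<open>auto simp: indicator_def\<close>)
  finally show ?thesis .
qed

lemma exp_integral_cbox: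
  fixes a b c v :: "'a::euclidean_space"
  assumes ab: "\<And>i. i \<in> Basis \<Longrightarrow> a \<bullet> i \<le> b \<bullet> i" and v: "\<And>i. i \<in> Basis \<Longrightarrow> v \<bullet> i \<noteq> 0"
  shows "(LINT x:cbox a b|lebesgue. exp (v \<bullet> (x - c))) =
    (\<Prod>i\<in>Basis. (exp (v \<bullet> i * (b \<bullet> i - c \<bullet> i)) - exp (v \<bullet> i * (a \<bullet> i - c \<bullet> i))) / (v \<bullet> i))"
    (is "_ = (\<Prod>i\<in>Basis. ?I i)")
proof -
  define f where "f = (\<lambda>i x. ennreal (exp (v \<bullet> i * (x - c \<bullet> i))) * indicator {a \<bullet> i..b \<bullet> i} x)"
  have fI: "integral\<^sup>N lborel (f i) = ennreal (?I i)" and I0: "0 \<le> ?I i" if i: "i \<in> Basis" for i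
  proof -
    let ?F = "\<lambda>x. exp (v \<bullet> i * (x - c \<bullet> i)) / (v \<bullet> i)"
    have D: "(?F has_real_derivative exp (v \<bullet> i * (x - c \<bullet> i))) (at x)" for x
      using v[OF i] by (auto intro!: derivative_eq_intros)
    have "integral\<^sup>N lborel (f i) = ennreal (?F (b \<bullet> i) - ?F (a \<bullet> i))"
      unfolding f_def by (rule nn_integral_FTC_Icc) (use D ab[OF i] in auto)
    then show "integral\<^sup>N lborel (f i) = ennreal (?I i)"
      by (simp add: diff_divide_distrib)
    have "?F (a \<bullet> i) \<le> ?F (b \<bullet> i)"
      using ab[OF i] by (rule DERIV_nonneg_imp_nondecreasing) (use D in \<open>auto intro!: exI\<close>)
    then show "0 \<le> ?I i"
      by (simp add: diff_divide_distrib)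
  qed
  have prod_f: "(\<Prod>i\<in>Basis. f i (x \<bullet> i)) = ennreal (indicator (cbox a b) x *\<^sub>R exp (v \<bullet> (x - c)))"
    for x
  proof (cases "x \<in> cbox a b")
    case True
    then have "(\<Prod>i\<in>Basis. f i (x \<bullet> i)) = (\<Prod>i\<in>Basis. ennreal (exp (v \<bullet> i * (x \<bullet> i - c \<bullet> i))))"
      by (intro prod.cong) (auto simp: f_def mem_box)
    also have "\<dots> = ennreal (exp (\<Sum>i\<in>Basis. v \<bullet> i * (x \<bullet> i - c \<bullet> i)))"
      by (simp add: prod_ennreal exp_sum)
    also have "(\<Sum>i\<in>Basis. v \<bullet> i * (x \<bullet> i - c \<bullet> i)) = v \<bullet> (x - c)"
      by (subst euclidean_inner) (simp add: inner_diff_left)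
    finally show ?thesis using True by simp
  next
    case False
    then obtain i where "i \<in> Basis" "f i (x \<bullet> i) = 0"
      by (auto simp: mem_box f_def)
    then have "(\<Prod>i\<in>Basis. f i (x \<bullet> i)) = 0"
      by (intro prod_zero) auto
    then show ?thesis using False by simp
  qed
  have int: "integrable lebesgue (\<lambda>x. indicator (cbox a b) x *\<^sub>R exp (v \<bullet> (x - c)))"
    using absolutely_integrable_continuous[of a b "\<lambda>x. exp (v \<bullet> (x - c))"]
    by (simp add: set_integrable_def continuous_intros)
  have "ennreal (LINT x:cbox a b|lebesgue. exp (v \<bullet> (x - c)))
      = (\<integral>\<^sup>+x. ennreal (indicator (cbox a b) x *\<^sub>R exp (v \<bullet> (x - c))) \<partial>lebesgue)"
    unfolding set_lebesgue_integral_def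
    by (rule nn_integral_eq_integral[OF int, symmetric]) (auto simp: indicator_def)
  also have "\<dots> = (\<integral>\<^sup>+x. (\<Prod>i\<in>Basis. f i (x \<bullet> i)) \<partial>lborel)"
    by (simp only: nn_integral_completion prod_f)
  also have "\<dots> = (\<Prod>i\<in>Basis. integral\<^sup>N lborel (f i))"
    by (rule nn_integral_lborel_prod) (auto simp: f_def)
  also have "\<dots> = ennreal (\<Prod>i\<in>Basis. ?I i)"
    using I0 by (simp add: fI prod_ennreal)
  finally show ?thesis
    by (subst (asm) ennreal_inj)
      (auto intro!: prod_nonneg I0 integral_nonneg simp: set_lebesgue_integral_def)
qed

section \<open>The volume bound\<close>

theorem theorem1p3:
  fixes K :: "(real ^ 'n) set" and m :: real
  assumes "m \<noteq> 0" and "-1 < m" and "m < 1"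
    and "K \<subseteq> cbox (- vec 1) (vec 1)"
    and "K \<in> sets lebesgue" and "measure lebesgue K > 0"
    and "barycenter K = m *\<^sub>R vec 1"
  shows "root CARD('n) (measure lebesgue K) < 2 * sqrt (1 - m\<^sup>2)"
proof -
  define t where "t = m / (1 - m\<^sup>2)"
  define r where "r = sinh t / t * exp (- (t * m))"
  have "m\<^sup>2 < 1"
    using assms by (simp add: abs_square_less_1)
  then have t: "t \<noteq> 0"
    using assms by (simp add: t_def)
  have comp: "(vec 1 :: real ^ 'n) \<bullet> i = 1" if "i \<in> Basis" for i
    using that by (auto simp: Basis_vec_def inner_axis)
  have "0 \<le> sinh t / t"
    by (auto simp: zero_le_divide_iff)
  then have r: "0 \<le> r"
    unfolding r_def by (intro mult_nonneg_nonneg) auto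
  have "(LINT x:K|lebesgue. x) = measure lebesgue K *\<^sub>R barycenter K"
    using assms(6) by (simp add: barycenter_def)
  then have "(LINT x:K|lebesgue. x) = measure lebesgue K *\<^sub>R (m *\<^sub>R vec 1)"
    by (simp add: assms(7))
  then have "measure lebesgue K
      \<le> (LINT x:cbox (- vec 1) (vec 1 :: real ^ 'n)|lebesgue.
          exp ((t *\<^sub>R vec 1) \<bullet> (x - m *\<^sub>R vec 1)))"
    by (rule measure_le_exp_integral[OF assms(4,5)])
  also have "\<dots> = (\<Prod>i\<in>(Basis :: (real ^ 'n) set). (exp (t * (1 - m)) - exp (t * (- 1 - m))) / t)"
    using t by (subst exp_integral_cbox) (simp_all add: comp del: vec_1)
  also have "\<dots> = ((exp (t * (1 - m)) - exp (t * (- 1 - m))) / t) ^ CARD('n)"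
    by simp
  also have "(exp (t * (1 - m)) - exp (t * (- 1 - m))) / t = 2 * r"
  proof -
    have "exp (t * (1 - m)) - exp (t * (- 1 - m)) = (exp t - exp (- t)) * exp (- (t * m))"
      by (simp add: algebra_simps mult_exp_exp)
    then show ?thesis
      by (simp add: r_def sinh_field_def)
  qed
  finally have "root CARD('n) (measure lebesgue K) \<le> root CARD('n) ((2 * r) ^ CARD('n))"
    by simp
  also have "\<dots> = 2 * r"
    using r by (intro real_root_power_cancel) auto
  also have "\<dots> < 2 * sqrt (1 - m\<^sup>2)"
    using sinh_over_less_nonzero[OF assms(1-3)] by (simp add: r_def t_def)
  finally show ?thesis .
qed

end
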